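(* Let $p>0$ and $\eta\in(0,1)$. Let $\Omega\subseteq\mathbb{R}^n$, let $f:\Omega\to\mathbb{R}^n$ be continuous with $f(0)=0$ and solution map $\phi_f$, and let $G\subseteq\Omega$ be forward invariant for $f$. Suppose $T_f(x):=\sup\{t\ge0\mid\|\phi_f(x,t)\|_p^\eta>0\}$ is continuous for $x\in G\setminus\{0\}$. Then $f$ is finite-time stable on $G$ (with parameters $p,\eta$) with rate $k\ge0$ and gain $M\ge1$ if and only if there exists a continuous function $V:G\to\mathbb{R}_+$ such that $$M^{-1}\|x\|_p^\eta\le V(x)\le\|x\|_p^\eta\quad\forall x\in G,\qquad\dot V(x)\le-k\quad\forall x\in G\setminus\{0\},$$ where $\dot V(x):=D_t^+V(\phi_f(x,t))|_{t=0}$.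
   Context: $\mathbb{R}_+=[0,\infty)$. $\|\cdot\|_p$, $p>0$, is the $p$-(quasi)norm on $\mathbb{R}^n$. $\phi_f$ denotes the solution map of the ODE: $\partial_t\phi_f(x,t)=f(\phi_f(x,t))$, $\phi_f(x,0)=x$. Standing assumption: $\phi_f$ is well-defined, unique (for finite-time stable systems, uniqueness may be relaxed at the origin only), jointly continuous in $(x,t)$, and satisfies $\phi_f(\phi_f(x,t),s)=\phi_f(x,t+s)$ for $t,s\ge0$. $G\subseteq\Omega$ is forward invariant for $f$ if $\phi_f(x,t)\in G$ for all $x\in G$, $t\ge 0$. For given $p,\eta>0$, $f$ is finite-time stable on $G$ with rate $k\ge0$ and gain $M\ge1$ if for all $x\in G$: $\|\phi_f(x,t)\|_p^\eta\le M(\|x\|_p^\eta-kt)$ for $0\le t\le\frac1k\|x\|_p^\eta$ (for all $t\ge0$ if $k=0$), and $\|\phi_f(x,t)\|_p^\eta\le0$ otherwise; equivalently $\|\phi_f(x,t)\|_p^\eta\le M\max\{\|x\|_p^\eta-kt,0\}$ for all $t\ge0$. $D_t^+v(t)=\limsup_{h\to0^+}\frac{v(t+h)-v(t)}{h}$ is the upper right-hand Dini derivative. *)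

theory Defs
  imports "HOL-Analysis.Analysis"
begin

definition p_norm :: "real \<Rightarrow> real ^ 'n \<Rightarrow> real" where
  "p_norm p x = (\<Sum>i\<in>UNIV. \<bar>x $ i\<bar> powr p) powr (1 / p)"

definition ode_solution_on ::
    "(real ^ 'n) set \<Rightarrow> (real ^ 'n \<Rightarrow> real ^ 'n) \<Rightarrow> real set \<Rightarrow> (real \<Rightarrow> real ^ 'n) \<Rightarrow> bool" where
  "ode_solution_on \<Omega> f I y \<longleftrightarrow>
     (\<forall>t\<in>I. y t \<in> \<Omega> \<and> (y has_vector_derivative f (y t)) (at t within I))"

text \<open>
  Uniqueness is required only for trajectories that have not yet met the origin, so that
  non-Lipschitz fields such as \<open>x \<mapsto> - sgn x * sqrt \<bar>x\<bar>\<close> are covered; nothing is assumed about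
  uniqueness of the solutions that start at the origin. Values of \<open>\<phi>\<close> at points outside \<open>\<Omega>\<close> or at
  negative times are irrelevant.
\<close>

definition solution_map ::
    "(real ^ 'n) set \<Rightarrow> (real ^ 'n \<Rightarrow> real ^ 'n) \<Rightarrow> (real ^ 'n \<Rightarrow> real \<Rightarrow> real ^ 'n) \<Rightarrow> bool" where
  "solution_map \<Omega> f \<phi> \<longleftrightarrow>
     (\<forall>x\<in>\<Omega>. \<phi> x 0 = x \<and> ode_solution_on \<Omega> f {0..} (\<phi> x)) \<and>
     (\<forall>x\<in>\<Omega>. \<forall>y. \<forall>\<tau>>0.
        ode_solution_on \<Omega> f {0..<\<tau>} y \<and> y 0 = x \<and> (\<forall>t\<in>{0..<\<tau>}. y t \<noteq> 0) \<longrightarrow>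
        (\<forall>t\<in>{0..<\<tau>}. y t = \<phi> x t)) \<and>
     continuous_on (\<Omega> \<times> {0..}) (\<lambda>(x, t). \<phi> x t) \<and>
     (\<forall>x\<in>\<Omega>. \<forall>t\<ge>0. \<forall>s\<ge>0. \<phi> (\<phi> x t) s = \<phi> x (t + s))"

definition forward_invariant :: "(real ^ 'n \<Rightarrow> real \<Rightarrow> real ^ 'n) \<Rightarrow> (real ^ 'n) set \<Rightarrow> bool" where
  "forward_invariant \<phi> G \<longleftrightarrow> (\<forall>x\<in>G. \<forall>t\<ge>0. \<phi> x t \<in> G)"

text \<open>The case \<open>k = 0\<close> is listed separately because division by zero yields zero.\<close>

definition finite_time_stable ::
    "real \<Rightarrow> real \<Rightarrow> (real ^ 'n \<Rightarrow> real \<Rightarrow> real ^ 'n) \<Rightarrow> (real ^ 'n) set \<Rightarrow> real \<Rightarrow> real \<Rightarrow> bool" where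
  "finite_time_stable p \<eta> \<phi> G k M \<longleftrightarrow>
     (\<forall>x\<in>G. \<forall>t\<ge>0.
        if k = 0 \<or> t \<le> 1 / k * p_norm p x powr \<eta>
        then p_norm p (\<phi> x t) powr \<eta> \<le> M * (p_norm p x powr \<eta> - k * t)
        else p_norm p (\<phi> x t) powr \<eta> \<le> 0)"

text \<open>
  The supremum is taken in the extended reals, so trajectories that are nonzero at arbitrarily
  large times have settling time \<open>\<infinity>\<close>. For \<open>\<phi> x 0 = x \<noteq> 0\<close> the set contains \<open>0\<close>, hence the
  supremum is not the one of the empty set.

  A continuous settling time is to be understood as finite. For rate \<open>k > 0\<close> finiteness follows
  from finite-time stability as well as from the existence of a Lyapunov function, so it needs to be
  assumed only for \<open>k = 0\<close>. There it cannot be dropped: on \<open>[0, 3]\<close> let \<open>f\<close> vanish on \<open>[0, 1]\<close> and at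
  \<open>2\<close> and \<open>3\<close>, and be positive elsewhere. Then \<open>f\<close> is stable with rate \<open>0\<close> and gain \<open>M = 2 powr \<eta>\<close>,
  and the settling time is \<open>\<infinity>\<close> off the origin, but a Lyapunov function would satisfy
  \<open>V 3 \<le> V 2 \<le> V 1 \<le> 1 < (3 / 2) powr \<eta> \<le> V 3\<close>.
\<close>

definition settling_time :: "real \<Rightarrow> real \<Rightarrow> (real ^ 'n \<Rightarrow> real \<Rightarrow> real ^ 'n) \<Rightarrow> real ^ 'n \<Rightarrow> ereal" where
  "settling_time p \<eta> \<phi> x = (SUP t\<in>{t. t \<ge> 0 \<and> p_norm p (\<phi> x t) powr \<eta> > 0}. ereal t)"

definition upper_right_dini :: "(real \<Rightarrow> real) \<Rightarrow> real \<Rightarrow> ereal" where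
  "upper_right_dini v t = Limsup (at_right 0) (\<lambda>h. ereal ((v (t + h) - v t) / h))"

definition orbital_derivative ::
    "(real ^ 'n \<Rightarrow> real \<Rightarrow> real ^ 'n) \<Rightarrow> (real ^ 'n \<Rightarrow> real) \<Rightarrow> real ^ 'n \<Rightarrow> ereal" where
  "orbital_derivative \<phi> V x = upper_right_dini (\<lambda>t. V (\<phi> x t)) 0"

end

theory Submission imports Defs
begin

text \<open>
  Write \<open>N x\<close> for the \<open>\<eta>\<close>-th power of the \<open>p\<close>-norm of \<open>x\<close>. Stability says that
  \<open>N (\<phi> x t) \<le> M * max (N x - k * t) 0\<close>. The equivalence is a fact about continuous semiflows whose
  states are measured by a continuous nonnegative function that vanishes exactly at the origin; the
  locale \<open>gauged_semiflow\<close> describes this situation.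

  A stable system has the Lyapunov function
  \<open>V x = (SUP t\<in>{0..T x}. N (\<phi> x t) / M + k * t)\<close>, where \<open>T x\<close> is the settling time
  (\<open>decay_imp_lyapunov\<close>). The value at \<open>t = 0\<close> gives the lower bound, and the decay estimate, with
  \<open>k * T x \<le> N x\<close>, bounds every term by \<open>N x\<close>. Moving \<open>x\<close> along its trajectory by time \<open>h\<close> takes the
  supremum over a tail of the same trajectory and subtracts \<open>k * h\<close> from each term, so \<open>V\<close> falls at
  rate at least \<open>k\<close>. Continuity off the origin holds because \<open>T\<close> is continuous: after rescaling
  time to \<open>{0..1}\<close>, the supremum is over a fixed compact set (\<open>continuous_on_SUP_compact\<close>). At the
  origin it follows from \<open>0 \<le> V x \<le> N x\<close>.

  Conversely, the bound on the Dini derivative integrates to \<open>V (\<phi> x t) \<le> V x - k * t\<close> as long as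
  the trajectory avoids the origin (\<open>dini_upper_bound_imp_decrease\<close>), and the two-sided bound on \<open>V\<close>
  turns this into the decay estimate (\<open>lyapunov_imp_decay\<close>). Solutions starting at the origin need
  not be unique, so it has to be shown that a trajectory stays at the origin once it is there. It
  does, since \<open>V\<close> would have to increase from zero right after the last visit
  (\<open>zero_is_absorbing\<close>).
\<close>

section \<open>Comparison for the upper right Dini derivative\<close>

text \<open>
  If the claim failed, the tilted function \<open>g t = w t + (k - \<delta>) * t\<close> would still end above
  its initial value, although its Dini derivative is negative. At the last point where \<open>g\<close> is at
  most an intermediate level, a negative derivative contradicts being last. The derivative is bounded
  on the open interval only, because the endpoint \<open>a\<close> may be a visit to the origin, about which
  the Lyapunov condition says nothing.
\<close>

lemma dini_upper_bound_imp_decrease: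
  fixes w :: "real \<Rightarrow> real"
  assumes "a \<le> b" and cont: "continuous_on {a..b} w"
    and dini: "\<And>t. a < t \<Longrightarrow> t < b \<Longrightarrow> upper_right_dini w t \<le> ereal (- k)"
  shows "w b \<le> w a - k * (b - a)"
proof (rule ccontr)
  assume "\<not> ?thesis"
  then have less: "w b > w a - k * (b - a)" and "a < b"
    using \<open>a \<le> b\<close> by (auto simp: less_le)
  \<comment> \<open>The slack \<open>\<delta>\<close> uses up half of the excess of \<open>w b\<close>, so that \<open>g a < g b\<close> survives.\<close>
  define \<delta> where "\<delta> = (w b - w a + k * (b - a)) / (2 * (b - a))"
  define g where "g t = w t + (k - \<delta>) * t" for t
  define mid where "mid = (g a + g b) / 2"
  define S where "S = {t \<in> {a..b}. g t \<le> mid}"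
  have "\<delta> > 0"
    using less \<open>a < b\<close> by (simp add: \<delta>_def)
  have "\<delta> * (b - a) = (w b - w a + k * (b - a)) / 2"
    using \<open>a < b\<close> by (simp add: \<delta>_def field_simps)
  then have "g a < g b"
    using less unfolding g_def by (simp add: algebra_simps)
  then have mid: "g a < mid" "mid < g b"
    by (simp_all add: mid_def)
  have cont_g: "continuous_on {a..b} g"
    unfolding g_def by (intro continuous_intros cont)
  \<comment> \<open>A level strictly above \<open>g a\<close> keeps the last point away from \<open>a\<close>.\<close>
  obtain a' where a': "a \<le> a'" "a' \<le> b" "g a' = mid"
    using IVT'[OF less_imp_le[OF mid(1)] less_imp_le[OF mid(2)] \<open>a \<le> b\<close> cont_g] by auto
  have "a < a'" "a' \<in> S"
    using a' mid by (auto simp: S_def less_le)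
  have "closed S"
    unfolding S_def by (intro continuous_on_closed_Collect_le cont_g continuous_on_const closed_atLeastAtMost)
  moreover have bdd: "bdd_above S"
    by (auto simp: S_def intro!: bdd_aboveI[of _ b])
  ultimately have "Sup S \<in> S"
    using \<open>a' \<in> S\<close> by (intro closed_contains_Sup) auto
  define m where "m = Sup S"
  have m: "g m \<le> mid" "a < m" "m < b"
    using \<open>Sup S \<in> S\<close> cSup_upper[OF \<open>a' \<in> S\<close> bdd] \<open>a < a'\<close> mid(2)
    by (auto simp: S_def m_def less_le)
  have "upper_right_dini w m < ereal (\<delta> - k)"
    using dini[OF m(2,3)] \<open>\<delta> > 0\<close> by (rule_tac le_less_trans) auto
  then have "\<forall>\<^sub>F h in at_right 0. ereal ((w (m + h) - w m) / h) < ereal (\<delta> - k)"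
    unfolding upper_right_dini_def by (rule Limsup_lessD)
  moreover have "\<forall>\<^sub>F h in at_right 0. h < b - m"
    using m by (intro eventually_at_right_less order_tendstoD(2)[OF tendsto_ident_at]) auto
  moreover have "\<forall>\<^sub>F h in at_right (0::real). 0 < h"
    by (simp add: eventually_at_right_less)
  ultimately have "\<forall>\<^sub>F h in at_right 0. (w (m + h) - w m) / h < \<delta> - k \<and> h < b - m \<and> 0 < h"
    by eventually_elim auto
  then obtain h where h: "(w (m + h) - w m) / h < \<delta> - k" "h < b - m" "0 < h"
    using eventually_happens'[OF trivial_limit_at_right_real] by blast
  have "w (m + h) - w m < (\<delta> - k) * h"
    using h by (simp add: pos_divide_less_eq)
  then have "g (m + h) \<le> g m"
    by (simp add: g_def algebra_simps)
  then have "m + h \<in> S"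
    using m h by (auto simp: S_def)
  then show False
    using cSup_upper[OF _ bdd] h by (fastforce simp: m_def)
qed

section \<open>Suprema over a compact parameter set\<close>

text \<open>
  By compactness of \<open>C\<close>, the functions \<open>F x\<close> converge to \<open>F x0\<close> uniformly on \<open>C\<close> as \<open>x\<close> tends to \<open>x0\<close>,
  and the supremum is 1-Lipschitz for the uniform distance.
\<close>

lemma continuous_on_SUP_compact:
  fixes F :: "'a::topological_space \<Rightarrow> 'b::topological_space \<Rightarrow> real"
  assumes cont: "continuous_on (U \<times> C) (\<lambda>(x, s). F x s)"
    and "compact C" and "C \<noteq> {}"
  shows "continuous_on U (\<lambda>x. SUP s\<in>C. F x s)"
  unfolding continuous_on_def
proof (intro ballI tendstoI)
  fix x0 and e :: real
  assume "x0 \<in> U" "e > 0"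
  have bdd: "bdd_above (F x ` C)" if "x \<in> U" for x
  proof -
    have "continuous_on C (\<lambda>s. (\<lambda>(x, s). F x s) (x, s))"
      using that by (intro continuous_on_compose2[OF cont] continuous_intros) auto
    then have "compact (F x ` C)"
      using \<open>compact C\<close> by (simp add: compact_continuous_image)
    then show ?thesis
      by (simp add: bounded_imp_bdd_above compact_imp_bounded)
  qed
  have le: "(SUP s\<in>C. F x s) \<le> (SUP s\<in>C. F y s) + d"
    if "y \<in> U" "\<And>s. s \<in> C \<Longrightarrow> F x s \<le> F y s + d" for x y d
  proof (rule cSUP_least[OF \<open>C \<noteq> {}\<close>])
    fix s assume "s \<in> C"
    then show "F x s \<le> (SUP s\<in>C. F y s) + d"
      using that(2)[of s] cSUP_upper[OF _ bdd[OF that(1)], of s] by linarith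
  qed
  obtain X0 where X0: "x0 \<in> X0" "open X0"
    "\<forall>x\<in>X0 \<inter> U. \<forall>s\<in>C. dist (F x s) (F x0 s) \<le> e / 2"
    using continuous_on_prod_compactE[OF cont \<open>compact C\<close> \<open>x0 \<in> U\<close> half_gt_zero[OF \<open>e > 0\<close>]]
    unfolding prod.case by metis
  have "dist (SUP s\<in>C. F x s) (SUP s\<in>C. F x0 s) < e" if "x \<in> X0" "x \<in> U" for x
  proof -
    have d: "F x s \<le> F x0 s + e / 2" "F x0 s \<le> F x s + e / 2" if "s \<in> C" for s
    proof -
      have "\<bar>F x s - F x0 s\<bar> \<le> e / 2"
        using X0(3) \<open>x \<in> X0\<close> \<open>x \<in> U\<close> that by (simp add: dist_real_def)
      then show "F x s \<le> F x0 s + e / 2" "F x0 s \<le> F x s + e / 2"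
        by linarith+
    qed
    have "(SUP s\<in>C. F x s) \<le> (SUP s\<in>C. F x0 s) + e / 2"
      by (rule le[OF \<open>x0 \<in> U\<close> d(1)])
    moreover have "(SUP s\<in>C. F x0 s) \<le> (SUP s\<in>C. F x s) + e / 2"
      by (rule le[OF \<open>x \<in> U\<close> d(2)])
    ultimately show ?thesis
      using \<open>e > 0\<close> by (simp add: dist_real_def abs_less_iff)
  qed
  then show "\<forall>\<^sub>F x in at x0 within U. dist (SUP s\<in>C. F x s) (SUP s\<in>C. F x0 s) < e"
    unfolding eventually_at_topological using X0(1,2) by blast
qed

section \<open>Semiflows measured by a gauge\<close>

locale gauged_semiflow =
  fixes G :: "'a::real_normed_vector set"
    and \<phi> :: "'a \<Rightarrow> real \<Rightarrow> 'a"
    and N :: "'a \<Rightarrow> real"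
  assumes flow_0: "x \<in> G \<Longrightarrow> \<phi> x 0 = x"
    and flow_in: "x \<in> G \<Longrightarrow> t \<ge> 0 \<Longrightarrow> \<phi> x t \<in> G"
    and flow_add: "x \<in> G \<Longrightarrow> t \<ge> 0 \<Longrightarrow> s \<ge> 0 \<Longrightarrow> \<phi> (\<phi> x t) s = \<phi> x (t + s)"
    and flow_cont: "continuous_on (G \<times> {0..}) (\<lambda>(x, t). \<phi> x t)"
    and gauge_cont: "continuous_on UNIV N"
    and gauge_nonneg: "N x \<ge> 0"
    and gauge_eq_0: "N x = 0 \<longleftrightarrow> x = 0"
begin

lemma trajectory_cont: "x \<in> G \<Longrightarrow> continuous_on {0..} (\<phi> x)"
  using continuous_on_compose2[OF flow_cont, of "{0..}" "\<lambda>t. (x, t)"]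
  by (simp add: continuous_on_Pair image_subset_iff)

lemma decrease_along_nonzero_piece:
  assumes V: "continuous_on G V"
    and dini: "\<And>y. y \<in> G - {0} \<Longrightarrow>
      upper_right_dini (\<lambda>t. V (\<phi> y t)) 0 \<le> ereal (- k)"
    and "x \<in> G" "0 \<le> a" "a \<le> b"
    and nz: "\<And>t. a < t \<Longrightarrow> t < b \<Longrightarrow> \<phi> x t \<noteq> 0"
  shows "V (\<phi> x b) \<le> V (\<phi> x a) - k * (b - a)"
proof (rule dini_upper_bound_imp_decrease[OF \<open>a \<le> b\<close>])
  show "continuous_on {a..b} (\<lambda>t. V (\<phi> x t))"
    using assms flow_in
    by (intro continuous_on_compose2[OF V] continuous_on_subset[OF trajectory_cont]) auto
next
  fix t assume t: "a < t" "t < b"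
  have "upper_right_dini (\<lambda>t. V (\<phi> x t)) t = upper_right_dini (\<lambda>s. V (\<phi> (\<phi> x t) s)) 0"
    unfolding upper_right_dini_def
  proof (rule Limsup_eq)
    show "\<forall>\<^sub>F h in at_right 0. ereal ((V (\<phi> x (t + h)) - V (\<phi> x t)) / h) =
        ereal ((V (\<phi> (\<phi> x t) (0 + h)) - V (\<phi> (\<phi> x t) 0)) / h)"
      using eventually_at_right_less[of "0::real"]
      by eventually_elim (use t assms in \<open>simp add: flow_add flow_0 flow_in\<close>)
  qed
  also have "\<dots> \<le> ereal (- k)"
    using t assms flow_in nz by (intro dini) auto
  finally show "upper_right_dini (\<lambda>t. V (\<phi> x t)) t \<le> ereal (- k)" .
qed

text \<open>
  After the last visit to the origin before time \<open>t\<close> the trajectory is nonzero, so \<open>V\<close> cannot have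
  grown from its value 0 there. As \<open>V\<close> dominates \<open>N\<close> up to a factor, the trajectory has not left.
\<close>

lemma zero_is_absorbing:
  assumes V: "continuous_on G V"
    and dini: "\<And>y. y \<in> G - {0} \<Longrightarrow>
      upper_right_dini (\<lambda>t. V (\<phi> y t)) 0 \<le> ereal (- k)"
    and "k \<ge> 0" and "M > 0"
    and lower: "\<And>y. y \<in> G \<Longrightarrow> N y \<le> M * V y"
    and upper: "\<And>y. y \<in> G \<Longrightarrow> V y \<le> N y"
    and "x \<in> G" "0 \<le> s" "s \<le> t" "\<phi> x s = 0"
  shows "\<phi> x t = 0"
proof (rule ccontr)
  assume nz: "\<phi> x t \<noteq> 0"
  define Z where "Z = {r \<in> {s..t}. \<phi> x r = 0}"
  have "continuous_on {s..t} (\<phi> x)"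
    using assms by (intro continuous_on_subset[OF trajectory_cont]) auto
  then have "closed Z"
    unfolding Z_def using continuous_closed_preimage_constant by blast
  moreover have bdd: "bdd_above Z"
    by (auto simp: Z_def intro!: bdd_aboveI[of _ t])
  ultimately have "Sup Z \<in> Z"
    using assms by (intro closed_contains_Sup) (auto simp: Z_def)
  then have z: "s \<le> Sup Z" "Sup Z \<le> t" "\<phi> x (Sup Z) = 0"
    by (auto simp: Z_def)
  have "\<phi> x r \<noteq> 0" if "Sup Z < r" "r < t" for r
    using that z cSup_upper[OF _ bdd, of r] by (auto simp: Z_def)
  then have "V (\<phi> x t) \<le> V (\<phi> x (Sup Z)) - k * (t - Sup Z)"
    using z assms by (intro decrease_along_nonzero_piece[OF V dini]) auto
  also have "\<dots> \<le> V 0"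
    using z \<open>k \<ge> 0\<close> by simp
  also have "\<dots> \<le> 0"
  proof -
    have "0 \<in> G"
      using flow_in[of x s] assms by simp
    then show ?thesis
      using upper[of 0] gauge_eq_0[of 0] by simp
  qed
  finally have "N (\<phi> x t) \<le> 0"
    using lower[of "\<phi> x t"] flow_in[of x t] assms
    by (smt (verit) mult_nonneg_nonpos)
  then show False
    using nz gauge_nonneg[of "\<phi> x t"] gauge_eq_0[of "\<phi> x t"] by simp
qed

theorem lyapunov_imp_decay:
  assumes V: "continuous_on G V"
    and dini: "\<And>y. y \<in> G - {0} \<Longrightarrow>
      upper_right_dini (\<lambda>t. V (\<phi> y t)) 0 \<le> ereal (- k)"
    and "k \<ge> 0" and "M > 0"
    and lower: "\<And>y. y \<in> G \<Longrightarrow> N y \<le> M * V y"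
    and upper: "\<And>y. y \<in> G \<Longrightarrow> V y \<le> N y"
    and "x \<in> G" "t \<ge> 0"
  shows "N (\<phi> x t) \<le> M * max (N x - k * t) 0"
proof (cases "\<phi> x t = 0")
  case True
  then show ?thesis
    using \<open>M > 0\<close> gauge_eq_0[of 0] by simp
next
  case False
  have "\<phi> x s \<noteq> 0" if "0 < s" "s < t" for s
    using zero_is_absorbing[OF V dini \<open>k \<ge> 0\<close> \<open>M > 0\<close> lower upper \<open>x \<in> G\<close>, of s t] that False by auto
  then have "V (\<phi> x t) \<le> V (\<phi> x 0) - k * (t - 0)"
    using assms by (intro decrease_along_nonzero_piece[OF V dini]) auto
  also have "\<dots> \<le> max (N x - k * t) 0"
    using upper[of x] assms by (simp add: flow_0 le_max_iff_disj)
  finally have "M * V (\<phi> x t) \<le> M * max (N x - k * t) 0"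
    using \<open>M > 0\<close> by (intro mult_left_mono) auto
  then show ?thesis
    using lower[OF flow_in[OF \<open>x \<in> G\<close> \<open>t \<ge> 0\<close>]] by (rule order_trans[rotated])
qed

text \<open>
  \<open>T\<close> is the settling time, given by its property as the least upper bound of the times at which the
  trajectory is nonzero. In this form it is immediate that a nonzero point reached after time \<open>h\<close>
  has settling time at most \<open>T x - h\<close>.
\<close>

theorem decay_imp_lyapunov:
  assumes decay: "\<And>x t. x \<in> G \<Longrightarrow> t \<ge> 0 \<Longrightarrow> N (\<phi> x t) \<le> M * max (N x - k * t) 0"
    and "k \<ge> 0" and "M > 0"
    and T_cont: "continuous_on (G - {0}) T"
    and T_least: "\<And>x b. x \<in> G - {0} \<Longrightarrow> T x \<le> b \<longleftrightarrow> (\<forall>t\<ge>0. \<phi> x t \<noteq> 0 \<longrightarrow> t \<le> b)"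
  obtains V where "continuous_on G V"
    and "\<And>x. x \<in> G \<Longrightarrow> N x \<le> M * V x" and "\<And>x. x \<in> G \<Longrightarrow> V x \<le> N x"
    and "\<And>x. x \<in> G - {0} \<Longrightarrow> upper_right_dini (\<lambda>t. V (\<phi> x t)) 0 \<le> ereal (- k)"
proof -
  define g where "g x t = N (\<phi> x t) / M + k * t" for x t
  \<comment> \<open>Rescaled time makes the index set independent of \<open>x\<close>; \<open>W_upper\<close> and \<open>W_least\<close> restore \<open>{0..T x}\<close>.\<close>
  define W where "W x = (SUP s\<in>{0..1}. g x (s * T x))" for x
  \<comment> \<open>At the origin nothing is known about \<open>T\<close>, and the bounds on \<open>V\<close> force the value 0.\<close>
  define V where "V x = (if x = 0 then 0 else W x)" for x
  have T_upper: "t \<le> T x" if "x \<in> G - {0}" "t \<ge> 0" "\<phi> x t \<noteq> 0" for x t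
    using T_least[OF that(1), of "T x"] that by auto
  have T_nonneg: "T x \<ge> 0" if "x \<in> G - {0}" for x
    using T_upper[OF that, of 0] that by (simp add: flow_0)
  have kT: "k * T x \<le> N x" if x: "x \<in> G - {0}" for x
  proof (cases "k = 0")
    case True
    then show ?thesis by (simp add: gauge_nonneg)
  next
    case False
    then have "k > 0" using \<open>k \<ge> 0\<close> by simp
    have "t \<le> N x / k" if "t \<ge> 0" "\<phi> x t \<noteq> 0" for t
    proof (rule ccontr)
      assume "\<not> t \<le> N x / k"
      then have "N x < k * t"
        using \<open>k > 0\<close> by (simp add: field_simps)
      then have "N (\<phi> x t) \<le> 0"
        using decay[of x t] x that by (simp add: max_def)
      then show False
        using that gauge_nonneg[of "\<phi> x t"] gauge_eq_0[of "\<phi> x t"] by simp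
    qed
    then have "T x \<le> N x / k"
      using T_least[OF x] by blast
    then show ?thesis
      using \<open>k > 0\<close> by (simp add: field_simps)
  qed
  have g_le: "g x t \<le> N x" if "x \<in> G - {0}" "0 \<le> t" "t \<le> T x" for x t
  proof -
    have "k * t \<le> N x"
      using kT[OF that(1)] mult_left_mono[OF that(3) \<open>k \<ge> 0\<close>] by simp
    then have "N (\<phi> x t) \<le> M * (N x - k * t)"
      using decay[of x t] that by (simp add: max_def split: if_splits)
    then show ?thesis
      using \<open>M > 0\<close> by (simp add: g_def field_simps)
  qed
  have scaled: "0 \<le> s * T x" "s * T x \<le> T x" if "x \<in> G - {0}" "s \<in> {0..1}" for x s
    using that T_nonneg[OF that(1)] by (auto simp: mult_left_le_one_le)
  have W_upper: "g x t \<le> W x" if x: "x \<in> G - {0}" and t: "0 \<le> t" "t \<le> T x" for x t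
  proof -
    have "g x (t / T x * T x) \<le> W x"
      unfolding W_def
    proof (rule cSUP_upper)
      show "t / T x \<in> {0..1}"
        using t by (auto simp: divide_le_eq_1 less_le)
      show "bdd_above ((\<lambda>s. g x (s * T x)) ` {0..1})"
        by (rule bdd_aboveI2[of _ _ "N x"]) (rule g_le[OF x scaled[OF x]])
    qed
    moreover have "t / T x * T x = t"
      using t by (cases "T x = 0") auto
    ultimately show ?thesis by simp
  qed
  have W_least: "W x \<le> c"
    if "x \<in> G - {0}" "\<And>t. 0 \<le> t \<Longrightarrow> t \<le> T x \<Longrightarrow> g x t \<le> c" for x c
    unfolding W_def
    by (rule cSUP_least) (auto intro!: that(2) scaled[OF that(1), simplified])
  have V_upper: "V x \<le> N x" if "x \<in> G" for x
    using that W_least[of x "N x"] g_le by (auto simp: V_def gauge_nonneg)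
  have V_lower: "N x \<le> M * V x" if "x \<in> G" for x
  proof (cases "x = 0")
    case True
    then show ?thesis
      using gauge_eq_0[of 0] by (simp add: V_def)
  next
    case False
    then have "N x / M \<le> V x"
      using that W_upper[of x 0] T_nonneg[of x] by (simp add: V_def g_def flow_0)
    then show ?thesis
      using \<open>M > 0\<close> by (simp add: field_simps)
  qed
  \<comment> \<open>The supremum at \<open>\<phi> x h\<close> runs over the part of the trajectory of \<open>x\<close> after time \<open>h\<close>.\<close>
  have W_shift: "W (\<phi> x h) \<le> W x - k * h" if x: "x \<in> G - {0}" and h: "h \<ge> 0" "\<phi> x h \<noteq> 0" for x h
  proof (rule W_least)
    show y: "\<phi> x h \<in> G - {0}"
      using that flow_in by auto
    fix t assume t: "0 \<le> t" "t \<le> T (\<phi> x h)"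
    have "T (\<phi> x h) \<le> T x - h"
      unfolding T_least[OF y]
    proof (intro allI impI)
      fix r :: real assume "r \<ge> 0" "\<phi> (\<phi> x h) r \<noteq> 0"
      then show "r \<le> T x - h"
        using T_upper[OF x, of "h + r"] x h by (simp add: flow_add)
    qed
    then have "g x (h + t) \<le> W x"
      using t h x by (intro W_upper) auto
    then show "g (\<phi> x h) t \<le> W x - k * h"
      using x h t by (simp add: g_def flow_add algebra_simps)
  qed
  have dini: "upper_right_dini (\<lambda>t. V (\<phi> x t)) 0 \<le> ereal (- k)" if x: "x \<in> G - {0}" for x
    unfolding upper_right_dini_def
  proof (rule Limsup_bounded)
    have "(\<phi> x \<longlongrightarrow> \<phi> x 0) (at 0 within {0..})"
      using trajectory_cont[of x] x by (simp add: continuous_on_def)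
    then have "(\<phi> x \<longlongrightarrow> \<phi> x 0) (at_right 0)"
      by (rule tendsto_within_subset) auto
    then have "\<forall>\<^sub>F h in at_right 0. \<phi> x h \<noteq> 0"
      using x by (intro tendsto_imp_eventually_ne) (auto simp: flow_0)
    then show "\<forall>\<^sub>F h in at_right 0.
        ereal ((V (\<phi> x (0 + h)) - V (\<phi> x 0)) / h) \<le> ereal (- k)"
      using eventually_at_right_less[of "0::real"]
    proof eventually_elim
      case (elim h)
      have "V (\<phi> x h) - V (\<phi> x 0) \<le> - k * h"
        using W_shift[OF x, of h] elim x by (simp add: V_def flow_0)
      then show ?case
        using elim by (simp add: pos_divide_le_eq)
    qed
  qed
  have "continuous_on (G - {0}) W"
    unfolding W_def
  proof (rule continuous_on_SUP_compact)
    let ?D = "(G - {0}) \<times> {0..1::real}"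
    have "continuous_on ?D (\<lambda>z. T (fst z))"
      by (rule continuous_on_compose2[OF T_cont continuous_on_fst[OF continuous_on_id]]) auto
    then have scale_cont: "continuous_on ?D (\<lambda>z. snd z * T (fst z))"
      by (rule continuous_on_mult[OF continuous_on_snd[OF continuous_on_id]])
    have "continuous_on ?D (\<lambda>z. (fst z, snd z * T (fst z)))"
      by (rule continuous_on_Pair[OF continuous_on_fst[OF continuous_on_id] scale_cont])
    then have "continuous_on ?D (\<lambda>z. case (fst z, snd z * T (fst z)) of (x, t) \<Rightarrow> \<phi> x t)"
      by (rule continuous_on_compose2[OF flow_cont]) (auto simp: T_nonneg)
    then have "continuous_on ?D (\<lambda>z. N (\<phi> (fst z) (snd z * T (fst z))))"
      unfolding prod.case by (rule continuous_on_compose2[OF gauge_cont _ subset_UNIV])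
    then have "continuous_on ?D (\<lambda>z. N (\<phi> (fst z) (snd z * T (fst z))) / M)"
      using \<open>M > 0\<close> by (intro continuous_on_divide continuous_on_const) auto
    then show "continuous_on ?D (\<lambda>(x, s). g x (s * T x))"
      unfolding g_def case_prod_beta
      by (rule continuous_on_add[OF _ continuous_on_mult_left[OF scale_cont]])
  qed auto
  then have cont_off_0: "continuous_on (G - {0}) V"
    by (rule continuous_on_eq) (auto simp: V_def)
  have "continuous_on G V"
    unfolding continuous_on_def
  proof
    fix x assume "x \<in> G"
    show "(V \<longlongrightarrow> V x) (at x within G)"
    proof (cases "x = 0")
      case False
      then have "at x within G = at x within (G - {0})"
        by (intro at_within_nhd[of _ "- {0}"]) auto
      then show ?thesis
        using cont_off_0 False \<open>x \<in> G\<close> by (simp add: continuous_on_def)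
    next
      case True
      have "(N \<longlongrightarrow> N 0) (at 0 within G)"
        using gauge_cont by (auto simp: continuous_on_def intro: tendsto_within_subset)
      moreover have "\<forall>\<^sub>F y in at 0 within G. norm (V y) \<le> N y"
        unfolding eventually_at_topological
      proof (intro exI[of _ UNIV] conjI ballI impI)
        fix y assume "y \<in> G"
        have "0 \<le> M * V y"
          using V_lower[OF \<open>y \<in> G\<close>] gauge_nonneg[of y] by simp
        then show "norm (V y) \<le> N y"
          using \<open>M > 0\<close> V_upper[OF \<open>y \<in> G\<close>] by (simp add: zero_le_mult_iff)
      qed auto
      ultimately have "(V \<longlongrightarrow> 0) (at 0 within G)"
        using gauge_eq_0[of 0] by (auto intro: Lim_null_comparison)
      then show ?thesis
        using True by (simp add: V_def)
    qed
  qed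
  then show thesis
    by (rule that[OF _ V_lower V_upper dini])
qed

end

section \<open>The power of the quasinorm as a gauge\<close>

lemma p_norm_nonneg: "p_norm p x \<ge> 0"
  by (simp add: p_norm_def)

lemma p_norm_eq_0_iff: "p_norm p x = 0 \<longleftrightarrow> x = 0"
  by (auto simp: p_norm_def sum_nonneg_eq_0_iff vec_eq_iff)

lemma continuous_on_p_norm: "p > 0 \<Longrightarrow> continuous_on S (p_norm p)"
  unfolding p_norm_def by (intro continuous_on_powr' continuous_intros) (auto intro: sum_nonneg)

text \<open>
  For \<open>k > 0\<close>, the case distinction in the definition is the one by the sign of
  \<open>p_norm p x powr \<eta> - k * t\<close>. For \<open>k = 0\<close> this difference is never negative.
\<close>

lemma finite_time_stable_iff_decay:
  assumes "k \<ge> 0"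
  shows "finite_time_stable p \<eta> \<phi> G k M \<longleftrightarrow>
    (\<forall>x\<in>G. \<forall>t\<ge>0. p_norm p (\<phi> x t) powr \<eta> \<le> M * max (p_norm p x powr \<eta> - k * t) 0)"
proof -
  have "(if k = 0 \<or> t \<le> 1 / k * a then b \<le> M * (a - k * t) else b \<le> 0) \<longleftrightarrow>
      b \<le> M * max (a - k * t) 0" if "a \<ge> 0" for a b t :: real
    using assms that by (cases "k = 0") (auto simp: max_def field_simps)
  then show ?thesis
    by (simp add: finite_time_stable_def)
qed

text \<open>
  With this, the settling time is handled by its order property alone. A trajectory that starts
  off the origin is nonzero at time 0, so the bound \<open>b = - 1\<close> fails there and the settling time is not
  \<open>- \<infinity>\<close>.
\<close>

lemma settling_time_le_iff:
  "settling_time p \<eta> \<phi> x \<le> ereal b \<longleftrightarrow> (\<forall>t\<ge>0. \<phi> x t \<noteq> 0 \<longrightarrow> t \<le> b)"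
  by (auto simp: settling_time_def SUP_le_iff p_norm_eq_0_iff)

section \<open>Finite-time stability and Lyapunov functions\<close>

theorem corollary28:
  fixes p \<eta> k M :: real
    and \<Omega> G :: "(real ^ 'n) set"
    and f :: "real ^ 'n \<Rightarrow> real ^ 'n"
    and \<phi> :: "real ^ 'n \<Rightarrow> real \<Rightarrow> real ^ 'n"
  assumes "p > 0" and "0 < \<eta>" and "\<eta> < 1"
    and "continuous_on \<Omega> f" and "0 \<in> \<Omega>" and "f 0 = 0"
    and "solution_map \<Omega> f \<phi>"
    and "G \<subseteq> \<Omega>" and "forward_invariant \<phi> G"
    and "continuous_on (G - {0}) (settling_time p \<eta> \<phi>)"
    and "k = 0 \<Longrightarrow> \<forall>x\<in>G - {0}. settling_time p \<eta> \<phi> x < \<infinity>"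
    and "k \<ge> 0" and "M \<ge> 1"
  shows "finite_time_stable p \<eta> \<phi> G k M \<longleftrightarrow>
    (\<exists>V :: real ^ 'n \<Rightarrow> real.
       continuous_on G V \<and> (\<forall>x\<in>G. V x \<ge> 0) \<and>
       (\<forall>x\<in>G. inverse M * p_norm p x powr \<eta> \<le> V x \<and> V x \<le> p_norm p x powr \<eta>) \<and>
       (\<forall>x\<in>G - {0}. orbital_derivative \<phi> V x \<le> ereal (- k)))"
proof -
  define N :: "real ^ 'n \<Rightarrow> real" where "N x = p_norm p x powr \<eta>" for x
  interpret gauged_semiflow G \<phi> N
  proof
    show "continuous_on (G \<times> {0..}) (\<lambda>(x, t). \<phi> x t)"
      using assms(7,8) unfolding solution_map_def
      by (meson Sigma_mono continuous_on_subset order_refl)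
    show "continuous_on UNIV N"
      unfolding N_def using \<open>p > 0\<close> \<open>0 < \<eta>\<close>
      by (intro continuous_on_powr' continuous_on_p_norm continuous_intros)
        (auto simp: p_norm_nonneg)
  qed (use assms(7-9) in \<open>auto simp: solution_map_def forward_invariant_def N_def p_norm_eq_0_iff\<close>)
  have stable: "finite_time_stable p \<eta> \<phi> G k M \<longleftrightarrow>
      (\<forall>x\<in>G. \<forall>t\<ge>0. N (\<phi> x t) \<le> M * max (N x - k * t) 0)"
    unfolding N_def by (rule finite_time_stable_iff_decay) fact
  have lower_iff: "inverse M * a \<le> b \<longleftrightarrow> a \<le> M * b" for a b :: real
    using \<open>M \<ge> 1\<close> by (simp add: field_simps)
  show ?thesis
  proof
    assume "finite_time_stable p \<eta> \<phi> G k M"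
    then have decay: "N (\<phi> x t) \<le> M * max (N x - k * t) 0" if "x \<in> G" "t \<ge> 0" for x t
      using stable that by blast
    define T where "T x = real_of_ereal (settling_time p \<eta> \<phi> x)" for x
    have T: "settling_time p \<eta> \<phi> x = ereal (T x)" if x: "x \<in> G - {0}" for x
    proof -
      have "settling_time p \<eta> \<phi> x < \<infinity>"
      proof (cases "k = 0")
        case True
        then show ?thesis using assms(11) x by blast
      next
        case False
        then have "k > 0" using \<open>k \<ge> 0\<close> by simp
        have "t \<le> N x / k" if "t \<ge> 0" "\<phi> x t \<noteq> 0" for t
        proof -
          have "N (\<phi> x t) > 0"
            using that gauge_nonneg[of "\<phi> x t"] gauge_eq_0[of "\<phi> x t"] by linarith
          then have "max (N x - k * t) 0 > 0"
            using decay[of x t] x that \<open>M \<ge> 1\<close> by (auto simp: max_def split: if_splits)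
          then show ?thesis
            using \<open>k > 0\<close> by (simp add: field_simps max_def split: if_splits)
        qed
        then have "settling_time p \<eta> \<phi> x \<le> ereal (N x / k)"
          by (simp add: settling_time_le_iff)
        then show ?thesis
          by (rule le_less_trans) simp
      qed
      moreover have "settling_time p \<eta> \<phi> x \<noteq> -\<infinity>"
        using settling_time_le_iff[of p \<eta> \<phi> x "-1"] x by (force simp: flow_0)
      ultimately show ?thesis
        by (cases "settling_time p \<eta> \<phi> x") (auto simp: T_def)
    qed
    have "continuous_on (G - {0}) (\<lambda>x. ereal (T x))"
      using assms(10) by (rule continuous_on_eq) (rule T)
    then have "continuous_on (G - {0}) T"
      by (simp add: continuous_on_def)
    moreover have "T x \<le> b \<longleftrightarrow> (\<forall>t\<ge>0. \<phi> x t \<noteq> 0 \<longrightarrow> t \<le> b)" if "x \<in> G - {0}" for x b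
      using settling_time_le_iff[of p \<eta> \<phi> x b] T[OF that] by simp
    moreover have "M > 0"
      using \<open>M \<ge> 1\<close> by simp
    ultimately obtain V where V: "continuous_on G V"
      "\<And>x. x \<in> G \<Longrightarrow> N x \<le> M * V x" "\<And>x. x \<in> G \<Longrightarrow> V x \<le> N x"
      "\<And>x. x \<in> G - {0} \<Longrightarrow> upper_right_dini (\<lambda>t. V (\<phi> x t)) 0 \<le> ereal (- k)"
      using decay_imp_lyapunov[OF decay \<open>k \<ge> 0\<close>] by blast
    have "V x \<ge> 0" if "x \<in> G" for x
      using V(2)[OF that] gauge_nonneg[of x] \<open>M > 0\<close> by (smt (verit) mult_pos_neg)
    then show "\<exists>V. continuous_on G V \<and> (\<forall>x\<in>G. V x \<ge> 0) \<and>
       (\<forall>x\<in>G. inverse M * p_norm p x powr \<eta> \<le> V x \<and> V x \<le> p_norm p x powr \<eta>) \<and>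
       (\<forall>x\<in>G - {0}. orbital_derivative \<phi> V x \<le> ereal (- k))"
      using V unfolding lower_iff orbital_derivative_def N_def by blast
  next
    assume "\<exists>V. continuous_on G V \<and> (\<forall>x\<in>G. V x \<ge> 0) \<and>
       (\<forall>x\<in>G. inverse M * p_norm p x powr \<eta> \<le> V x \<and> V x \<le> p_norm p x powr \<eta>) \<and>
       (\<forall>x\<in>G - {0}. orbital_derivative \<phi> V x \<le> ereal (- k))"
    then obtain V where V: "continuous_on G V"
      "\<And>x. x \<in> G \<Longrightarrow> N x \<le> M * V x" "\<And>x. x \<in> G \<Longrightarrow> V x \<le> N x"
      "\<And>x. x \<in> G - {0} \<Longrightarrow> upper_right_dini (\<lambda>t. V (\<phi> x t)) 0 \<le> ereal (- k)"
      unfolding lower_iff orbital_derivative_def N_def by blast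
    show "finite_time_stable p \<eta> \<phi> G k M"
      unfolding stable using lyapunov_imp_decay[OF V(1,4) \<open>k \<ge> 0\<close> _ V(2,3)] \<open>M \<ge> 1\<close> by simp
  qed
qed

end
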